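(* For each $n=1,\dots,n_i$, given $\mathbf V^{(n-1)}\in(S_h^k)^{n_e}$, the Crank-Nicolson system $$\int_0^1\frac{V_i^{(n)}-V_i^{(n-1)}}{\delta}W_i\,dy+a_i\big(l(\hat V_1^{(n)}),\dots,l(\hat V_{n_e}^{(n)})\big)b_2^{(n-1/2)}\int_0^1\frac{\partial\hat V_i^{(n)}}{\partial y}\frac{\partial W_i}{\partial y}\,dy-\int_0^1b_1^{(n-1/2)}\frac{\partial\hat V_i^{(n)}}{\partial y}W_i\,dy=\int_0^1g_i^{(n-1/2)}W_i\,dy$$ for all $W_i\in S_h^k$, $i=1,\dots,n_e$, where $\hat V_i^{(n)}=\frac12(V_i^{(n)}+V_i^{(n-1)})$, has a solution $\mathbf V^{(n)}=(V_1^{(n)},\dots,V_{n_e}^{(n)})\in(S_h^k)^{n_e}$.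
   Context: Let $n_e\ge1$ be an integer and $T>0$. Let $\alpha,\beta\in\mathcal C^2([0,T])$ with $\alpha',\beta'\in L_2(]0,T[)$, put $\gamma=\beta-\alpha$, assume that $\gamma$ is increasing on $[0,T[$, and that $0<\gamma_0<\gamma(t)<\gamma_1<\infty$, $|\gamma'(t)|\le\gamma'_{\max}$ and $|\alpha'(t)|\le\alpha'_{\max}$ for all $t\in[0,T]$. Put $\Omega_t=]\alpha(t),\beta(t)[$ and $\Omega=]0,1[$. For $i=1,\dots,n_e$: $f_i$ satisfies $\int_0^T\int_{\Omega_t}f_i^2\,dx\,dt<\infty$; $a_i:\mathbb R^{n_e}\to\mathbb R^+$ is Lipschitz-continuous with $0<m_a\le a_i(s)\le M_a$ for all $s\in\mathbb R^{n_e}$. Notation: $b_1(y,t)=\dfrac{\alpha'(t)+\gamma'(t)y}{\gamma(t)}$, $b_2(t)=\dfrac1{\gamma(t)^2}$, $g_i(y,t)=f_i(\alpha(t)+\gamma(t)y,t)$. Time is discretised with step $\delta>0$, $t_n=n\delta$, $n=0,\dots,n_i$, $T=n_i\delta$, and $t_{n-1/2}=\frac{t_n+t_{n-1}}2$; a superscript $(n-1/2)$ denotes evaluation at $t_{n-1/2}$, with $g_i^{(n-1/2)}=g_i(\cdot,t_{n-1/2})$ assumed to be in $L_2(\Omega)$. In the scheme, $l(w)=\gamma(t_{n-1/2})\int_0^1w(y)\,dy$. $\mathcal T_h$ is a partition of $\Omega$ into disjoint intervals of maximal length $h$; $S_h^k$ ($k\ge1$ an integer) is the space of continuous functions on $[0,1]$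 that vanish at $0$ and $1$ and are polynomials of degree $k$ on each interval of $\mathcal T_h$. *)

theory Defs
  imports "HOL-Analysis.Analysis" "HOL-Computational_Algebra.Polynomial"
begin

text \<open>Derivative on the closed interval \<open>[0,T]\<close>, one-sided at the two end points.\<close>

definition deriv_on :: "real \<Rightarrow> (real \<Rightarrow> real) \<Rightarrow> real \<Rightarrow> real" where
  "deriv_on T f t = vector_derivative f (at t within {0..T})"

definition C2_on :: "real \<Rightarrow> (real \<Rightarrow> real) \<Rightarrow> bool" where
  "C2_on T f \<longleftrightarrow>
     f differentiable_on {0..T} \<and>
     deriv_on T f differentiable_on {0..T} \<and>
     continuous_on {0..T} (deriv_on T (deriv_on T f))"

definition L2_on :: "'a::euclidean_space set \<Rightarrow> ('a \<Rightarrow> real) \<Rightarrow> bool" where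
  "L2_on S f \<longleftrightarrow>
     set_borel_measurable lebesgue S f \<and> set_integrable lebesgue S (\<lambda>x. (f x)\<^sup>2)"

definition gam :: "(real \<Rightarrow> real) \<Rightarrow> (real \<Rightarrow> real) \<Rightarrow> real \<Rightarrow> real" where
  "gam \<alpha> \<beta> t = \<beta> t - \<alpha> t"

text \<open>The coefficients obtained by mapping the moving domain \<open>]\<alpha> t, \<beta> t[\<close> to \<open>]0,1[\<close>.\<close>

definition b1 :: "real \<Rightarrow> (real \<Rightarrow> real) \<Rightarrow> (real \<Rightarrow> real) \<Rightarrow> real \<Rightarrow> real \<Rightarrow> real" where
  "b1 T \<alpha> \<beta> y t = (deriv_on T \<alpha> t + deriv_on T (gam \<alpha> \<beta>) t * y) / gam \<alpha> \<beta> t"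

definition b2 :: "(real \<Rightarrow> real) \<Rightarrow> (real \<Rightarrow> real) \<Rightarrow> real \<Rightarrow> real" where
  "b2 \<alpha> \<beta> t = 1 / (gam \<alpha> \<beta> t)\<^sup>2"

definition pullback ::
    "(real \<Rightarrow> real) \<Rightarrow> (real \<Rightarrow> real) \<Rightarrow> (real \<Rightarrow> real \<Rightarrow> real) \<Rightarrow> real \<Rightarrow> real \<Rightarrow> real" where
  "pullback \<alpha> \<beta> f y t = f (\<alpha> t + gam \<alpha> \<beta> t * y) t"

definition time_node :: "real \<Rightarrow> nat \<Rightarrow> real" where
  "time_node \<delta> n = real n * \<delta>"

text \<open>The midpoint \<open>t\<^bsub>n-1/2\<^esub>\<close>; only used for \<open>n \<ge> 1\<close>.\<close>

definition time_mid :: "real \<Rightarrow> nat \<Rightarrow> real" where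
  "time_mid \<delta> n = (time_node \<delta> n + time_node \<delta> (n - 1)) / 2"

text \<open>
  A finite partition of \<open>]0,1[\<close> into nondegenerate intervals with maximal length \<open>h\<close>. Which
  of two neighbouring intervals contains their common node is left open; it has no influence
  on the space \<open>S_hk\<close> below, whose elements are continuous.
\<close>

definition mesh :: "real set set \<Rightarrow> real \<Rightarrow> bool" where
  "mesh \<T> h \<longleftrightarrow>
     finite \<T> \<and> partition_on {0<..<1} \<T> \<and>
     (\<forall>K\<in>\<T>. is_interval K \<and> interior K \<noteq> {}) \<and>
     h = Max (diameter ` \<T>)"

text \<open>
  As usual for finite elements, polynomials of degree \<open>k\<close> means degree at most \<open>k\<close>. Only the
  values on \<open>[0,1]\<close> matter; elements are not normalised outside this interval.
\<close>

definition S_hk :: "real set set \<Rightarrow> nat \<Rightarrow> (real \<Rightarrow> real) set" where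
  "S_hk \<T> k = {v. continuous_on {0..1} v \<and> v 0 = 0 \<and> v 1 = 0 \<and>
     (\<forall>K\<in>\<T>. \<exists>p::real poly. degree p \<le> k \<and> (\<forall>y\<in>K. v y = poly p y))}"

text \<open>The nonlocal functional \<open>l\<close>; its first argument is the value of \<open>\<gamma>\<close> at the midpoint.\<close>

definition l_fun :: "real \<Rightarrow> (real \<Rightarrow> real) \<Rightarrow> real" where
  "l_fun c w = c * (LINT y:{0<..<1}|lebesgue. w y)"

definition midpt :: "('e \<Rightarrow> real \<Rightarrow> real) \<Rightarrow> ('e \<Rightarrow> real \<Rightarrow> real) \<Rightarrow> 'e \<Rightarrow> real \<Rightarrow> real" where
  "midpt U V i y = (V i y + U i y) / 2"

text \<open>
  The system at step \<open>n\<close>, with \<open>U\<close> the previous and \<open>V\<close> the new approximation. Functions in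
  \<open>S_hk\<close> are differentiable except possibly at the finitely many nodes, where \<open>deriv\<close> is an
  arbitrary number that does not affect the integrals.
\<close>

definition crank_nicolson ::
    "real \<Rightarrow> (real \<Rightarrow> real) \<Rightarrow> (real \<Rightarrow> real) \<Rightarrow> ('e::finite \<Rightarrow> real ^ 'e \<Rightarrow> real) \<Rightarrow>
     ('e \<Rightarrow> real \<Rightarrow> real \<Rightarrow> real) \<Rightarrow> real \<Rightarrow> real set set \<Rightarrow> nat \<Rightarrow> nat \<Rightarrow>
     ('e \<Rightarrow> real \<Rightarrow> real) \<Rightarrow> ('e \<Rightarrow> real \<Rightarrow> real) \<Rightarrow> bool" where
  "crank_nicolson T \<alpha> \<beta> a f \<delta> \<T> k n U V \<longleftrightarrow>
     (let t = time_mid \<delta> n; Vh = midpt U V in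
      \<forall>i. \<forall>W\<in>S_hk \<T> k.
        (LINT y:{0<..<1}|lebesgue. (V i y - U i y) / \<delta> * W y)
        + a i (\<chi> j. l_fun (gam \<alpha> \<beta> t) (Vh j)) * b2 \<alpha> \<beta> t *
            (LINT y:{0<..<1}|lebesgue. deriv (Vh i) y * deriv W y)
        - (LINT y:{0<..<1}|lebesgue. b1 T \<alpha> \<beta> y t * deriv (Vh i) y * W y)
        = (LINT y:{0<..<1}|lebesgue. pullback \<alpha> \<beta> (f i) y t * W y))"

end

theory Submission
  imports Defs
begin

text \<open>
  In terms of the midpoint value \<open>X = (V + U) / 2\<close>, and with the diffusion coefficients frozen at
  \<open>a\<^sub>i(s)\<close> for a vector \<open>s\<close>, the scheme decouples into linear problems for the \<open>X\<^sub>i\<close>. Their forms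
  are positive without any restriction on \<open>\<delta>\<close>: integration by parts turns the convection term at
  \<open>(W, W)\<close> into \<open>\<gamma>'/(2\<gamma>)\<close> times the squared norm of \<open>W\<close>, and \<open>\<gamma>' \<ge> 0\<close> as \<open>\<gamma>\<close> increases. So
  the frozen problem has a solution, whose \<open>L\<^sub>2\<close> norm is bounded independently of \<open>s\<close> and whose
  mean value depends continuously on \<open>s\<close>. A Brouwer fixed point of \<open>s \<mapsto> l(X(s))\<close> on a ball
  solves the nonlinear system.
\<close>

section \<open>Linear and bilinear forms on a set of functions\<close>

definition lin_closed :: "(real \<Rightarrow> real) set \<Rightarrow> bool" where
  "lin_closed S \<longleftrightarrow> (\<lambda>x. 0) \<in> S \<and> (\<forall>u\<in>S. \<forall>v\<in>S. \<forall>c d. (\<lambda>x. c * u x + d * v x) \<in> S)"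

text \<open>Linearity is relative to a set because \<open>deriv\<close> and the Lebesgue integral
  respect linear combinations only where derivatives exist and integrals converge.\<close>

definition lin_on :: "(real \<Rightarrow> real) set \<Rightarrow> ((real \<Rightarrow> real) \<Rightarrow> real) \<Rightarrow> bool" where
  "lin_on S l \<longleftrightarrow> (\<forall>u\<in>S. \<forall>v\<in>S. \<forall>c d. l (\<lambda>x. c * u x + d * v x) = c * l u + d * l v)"

definition bilin_on :: "(real \<Rightarrow> real) set \<Rightarrow> ((real \<Rightarrow> real) \<Rightarrow> (real \<Rightarrow> real) \<Rightarrow> real) \<Rightarrow> bool" where
  "bilin_on S A \<longleftrightarrow> (\<forall>w\<in>S. lin_on S (\<lambda>u. A u w) \<and> lin_on S (A w))"

lemma lin_closedD:
  "lin_closed S \<Longrightarrow> u \<in> S \<Longrightarrow> v \<in> S \<Longrightarrow> (\<lambda>x. c * u x + d * v x) \<in> S"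
  unfolding lin_closed_def by blast

lemma lin_onD:
  "lin_on S l \<Longrightarrow> u \<in> S \<Longrightarrow> v \<in> S \<Longrightarrow> l (\<lambda>x. c * u x + d * v x) = c * l u + d * l v"
  unfolding lin_on_def by blast

lemma lin_on_subset: "lin_on S l \<Longrightarrow> S' \<subseteq> S \<Longrightarrow> lin_on S' l"
  unfolding lin_on_def by blast

lemma bilin_onD1: "bilin_on S A \<Longrightarrow> w \<in> S \<Longrightarrow> lin_on S (\<lambda>u. A u w)"
  and bilin_onD2: "bilin_on S A \<Longrightarrow> w \<in> S \<Longrightarrow> lin_on S (A w)"
  unfolding bilin_on_def by auto

lemma bilin_on_subset: "bilin_on S A \<Longrightarrow> S' \<subseteq> S \<Longrightarrow> bilin_on S' A"
  unfolding bilin_on_def using lin_on_subset by blast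

text \<open>
  Lax-Milgram when finitely many point values determine an element of \<open>S\<close> as far as the forms
  can see it. Induction on \<open>P\<close>: the problem on \<open>S\<close> is reduced to the subspace of functions
  vanishing at one point \<open>p\<close> by making the complementary direction \<open>q\<close> orthogonal to it.
\<close>

lemma positive_form_solvable:
  assumes "finite P" "lin_closed S" "bilin_on S A" "lin_on S l"
    and "\<And>v. v \<in> S \<Longrightarrow> \<exists>p\<in>P. v p \<noteq> 0 \<Longrightarrow> A v v > 0"
    and "\<And>v. v \<in> S \<Longrightarrow> \<forall>p\<in>P. v p = 0 \<Longrightarrow> l v = 0"
    and "\<And>v w. v \<in> S \<Longrightarrow> w \<in> S \<Longrightarrow> \<forall>p\<in>P. v p = 0 \<Longrightarrow> A w v = 0"
  shows "\<exists>u\<in>S. \<forall>w\<in>S. A u w = l w"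
  using assms
proof (induction P arbitrary: S l rule: finite_induct)
  case empty
  \<comment> \<open>With no points left, the last two hypotheses make \<open>l\<close> and
    \<open>A\<close> vanish on \<open>S\<close>, so the zero function is a solution.\<close>
  then show ?case by (auto simp: lin_closed_def)
next
  case (insert p P)
  note S = \<open>lin_closed S\<close> and A = \<open>bilin_on S A\<close> and l = \<open>lin_on S l\<close>
  show ?case
  proof (cases "\<forall>v\<in>S. v p = 0")
    case True
    show ?thesis
      by (rule insert.IH) (use insert.prems True in auto)
  next
    case False
    then obtain w1 where w1: "w1 \<in> S" "w1 p \<noteq> 0" by blast
    \<comment> \<open>Normalised to 1 at \<open>p\<close>, so that every \<open>w\<close> in
      \<open>S\<close> is \<open>w p * w0\<close> plus a function in \<open>S0\<close>.\<close>
    define w0 where "w0 = (\<lambda>x. 1 / w1 p * w1 x + 0 * w1 x)"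
    have w0: "w0 \<in> S" "w0 p = 1"
      unfolding w0_def using w1 lin_closedD[OF S w1(1) w1(1), of "1 / w1 p" 0] by simp_all
    define S0 where "S0 = {v\<in>S. v p = 0}"
    have sub: "S0 \<subseteq> S" by (auto simp: S0_def)
    have S0: "lin_closed S0"
      using S by (auto simp: S0_def lin_closed_def)
    note A0 = bilin_on_subset[OF A sub]
    \<comment> \<open>The right-hand side stays arbitrary because the subspace problem is solved
      twice: for \<open>l\<close>, and for \<open>- A w0\<close>, which yields the correction
      \<open>z\<close> of \<open>w0\<close>.\<close>
    have solve: "\<exists>u\<in>S0. \<forall>w\<in>S0. A u w = l' w"
      if "lin_on S0 l'" "\<And>v. v \<in> S0 \<Longrightarrow> \<forall>p\<in>P. v p = 0 \<Longrightarrow> l' v = 0" for l'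
    proof (rule insert.IH[OF S0 A0 that(1)])
      show "0 < A v v" if "v \<in> S0" "\<exists>p\<in>P. v p \<noteq> 0" for v
        using that insert.prems(4)[of v] sub by auto
      show "l' v = 0" if "v \<in> S0" "\<forall>p\<in>P. v p = 0" for v
        using \<open>\<And>v. v \<in> S0 \<Longrightarrow> \<forall>p\<in>P. v p = 0 \<Longrightarrow> l' v = 0\<close> that by blast
      show "A w v = 0" if "v \<in> S0" "w \<in> S0" "\<forall>p\<in>P. v p = 0" for v w
        using that insert.prems(6)[of v w] by (auto simp: S0_def)
    qed
    have "\<exists>u\<in>S0. \<forall>w\<in>S0. A u w = l w"
      using insert.prems(5) by (intro solve lin_on_subset[OF l sub]) (auto simp: S0_def)
    then obtain u0 where u0: "u0 \<in> S0" "\<And>w. w \<in> S0 \<Longrightarrow> A u0 w = l w" by blast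
    have "\<exists>u\<in>S0. \<forall>w\<in>S0. A u w = - A w0 w"
    proof (rule solve)
      show "lin_on S0 (\<lambda>w. - A w0 w)"
        using lin_on_subset[OF bilin_onD2[OF A w0(1)] sub] by (simp add: lin_on_def)
      show "- A w0 v = 0" if "v \<in> S0" "\<forall>p\<in>P. v p = 0" for v
        using insert.prems(6)[of v w0] that w0 by (auto simp: S0_def)
    qed
    then obtain z where z: "z \<in> S0" "\<And>w. w \<in> S0 \<Longrightarrow> A z w = - A w0 w" by blast
    \<comment> \<open>\<open>q\<close> spans a complement of \<open>S0\<close> and satisfies
      \<open>A q w = 0\<close> for \<open>w\<close> in \<open>S0\<close>, so adding a multiple of it
      preserves the equations tested in \<open>S0\<close>.\<close>
    define q where "q = (\<lambda>x. 1 * w0 x + 1 * z x)"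
    have zS: "z \<in> S" and u0S: "u0 \<in> S" using z u0 sub by auto
    have qS: "q \<in> S" unfolding q_def by (rule lin_closedD[OF S w0(1) zS])
    have "q p = 1" using w0 z by (auto simp: q_def S0_def)
    have Aq: "A q w = A w0 w + A z w" if "w \<in> S" for w
      using lin_onD[OF bilin_onD1[OF A that] w0(1) zS, of 1 1] by (simp add: q_def)
    have Aq0: "A q w = 0" if "w \<in> S0" for w
      using Aq z that sub by auto
    have "A q q = A q w0 + A q z"
      using lin_onD[OF bilin_onD2[OF A qS] w0(1) zS, of 1 1] by (simp add: q_def)
    moreover have "A q q > 0" using insert.prems(4)[OF qS] \<open>q p = 1\<close> by auto
    ultimately have pos: "A q w0 > 0" using Aq0 z by auto
    \<comment> \<open>The equation tested with \<open>w0\<close> forces this value. The divisor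
      equals \<open>A q q\<close>, since \<open>A q z = 0\<close>.\<close>
    define c where "c = (l w0 - A u0 w0) / A q w0"
    define u where "u = (\<lambda>x. 1 * u0 x + c * q x)"
    have uS: "u \<in> S" unfolding u_def by (rule lin_closedD[OF S u0S qS])
    have Au: "A u w = A u0 w + c * A q w" if "w \<in> S" for w
      using lin_onD[OF bilin_onD1[OF A that] u0S qS, of 1 c] by (simp add: u_def)
    have "A u w = l w" if w: "w \<in> S" for w
    proof -
      define v where "v = (\<lambda>x. 1 * w x + (- w p) * w0 x)"
      have v: "v \<in> S0"
        unfolding S0_def v_def using lin_closedD[OF S w w0(1), of 1 "- w p"] w0 by simp
      have w_eq: "w = (\<lambda>x. 1 * v x + w p * w0 x)" by (auto simp: v_def)
      have "A u w0 = l w0" using Au[OF w0(1)] pos by (simp add: c_def)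
      moreover have "A u v = l v" using Au[of v] u0 Aq0 v sub by auto
      moreover have "A u w = A u v + w p * A u w0"
        using lin_onD[OF bilin_onD2[OF A uS], of v w0 1 "w p"] v sub w0 w_eq by auto
      moreover have "l w = l v + w p * l w0"
        using lin_onD[OF l, of v w0 1 "w p"] v sub w0 w_eq by auto
      ultimately show ?thesis by simp
    qed
    with uS show ?thesis by blast
  qed
qed

section \<open>Bounded measurable functions on the unit interval\<close>

abbreviation lebI :: "real measure" where "lebI \<equiv> lebesgue_on {0<..<1}"

text \<open>A single class for the finite element integrands: it contains the elements of
  \<open>S_hk\<close> and their derivatives, is closed under products and consists of integrable
  functions.\<close>

definition bddm :: "(real \<Rightarrow> real) \<Rightarrow> bool" where
  "bddm F \<longleftrightarrow> F \<in> borel_measurable lebI \<and> (\<exists>C. \<forall>y\<in>{0<..<1}. \<bar>F y\<bar> \<le> C)"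

lemma finite_measure_lebI: "finite_measure lebI"
  by (rule finite_measure_lebesgue_on) auto

lemma set_integral_lebI: "(LINT y:{0<..<1}|lebesgue. F y) = (LINT y|lebI. F y)"
  for F :: "real \<Rightarrow> real"
  unfolding set_lebesgue_integral_def by (subst integral_restrict_space) auto

lemma bddm_integrable: "bddm F \<Longrightarrow> integrable lebI F"
  unfolding bddm_def
  by (auto intro!: finite_measure.integrable_const_bound[OF finite_measure_lebI] AE_I2)

lemma bddm_const: "bddm (\<lambda>y. c)"
  unfolding bddm_def by auto

lemma bddm_mult:
  assumes "bddm F" "bddm G" shows "bddm (\<lambda>y. F y * G y)"
proof -
  obtain C D where "\<forall>y\<in>{0<..<1}. \<bar>F y\<bar> \<le> C" "\<forall>y\<in>{0<..<1}. \<bar>G y\<bar> \<le> D"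
    using assms unfolding bddm_def by blast
  then have "\<forall>y\<in>{0<..<1}. \<bar>F y * G y\<bar> \<le> C * D"
    unfolding abs_mult by (meson abs_ge_zero mult_mono order_trans)
  then show ?thesis using assms unfolding bddm_def by auto
qed

lemma bddm_continuous:
  assumes "continuous_on {0..1} F" shows "bddm F"
proof -
  have "F \<in> borel_measurable lebI"
    by (rule continuous_imp_measurable_on_sets_lebesgue[OF continuous_on_subset[OF assms]]) auto
  moreover have "bounded (F ` {0..1})"
    by (rule compact_imp_bounded[OF compact_continuous_image[OF assms]]) auto
  then obtain C where "\<forall>y\<in>{0..1}. \<bar>F y\<bar> \<le> C"
    unfolding bounded_iff by auto
  then have "\<forall>y\<in>{0<..<1}. \<bar>F y\<bar> \<le> C" by auto
  ultimately show ?thesis unfolding bddm_def by blast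
qed

lemma AE_lebI_finite:
  assumes "finite N" "\<And>y. y \<in> {0<..<1} - N \<Longrightarrow> Q y"
  shows "AE y in lebI. Q y"
proof -
  have "AE y in lebesgue. y \<notin> N"
    by (rule AE_not_in) (use assms(1) in \<open>simp add: negligible_finite flip: negligible_iff_null_sets\<close>)
  then show ?thesis
    by (subst AE_restrict_space_iff) (use assms in auto)
qed

text \<open>A nonnegative continuous function with zero integral over \<open>[0,1]\<close> vanishes
  there, so a single nonzero value suffices.\<close>

lemma lebI_integral_pos:
  fixes v :: "real \<Rightarrow> real"
  assumes "continuous_on {0..1} v" "p \<in> {0<..<1}" "v p \<noteq> 0"
  shows "(LINT y|lebI. (v y)\<^sup>2) > 0"
proof -
  have cont: "continuous_on {0..1} (\<lambda>y. (v y)\<^sup>2)"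
    by (intro continuous_intros assms)
  have "(LINT y|lebI. (v y)\<^sup>2) = integral {0<..<1} (\<lambda>y. (v y)\<^sup>2)"
    by (rule lebesgue_integral_eq_integral) (auto intro!: bddm_integrable bddm_continuous cont)
  also have "\<dots> = integral {0..1} (\<lambda>y. (v y)\<^sup>2)"
    by (simp add: integral_open_interval_real)
  also have "\<dots> \<noteq> 0"
    using integral_eq_0_iff[OF cont] assms(2,3) by force
  finally have "(LINT y|lebI. (v y)\<^sup>2) \<noteq> 0" .
  moreover have "(LINT y|lebI. (v y)\<^sup>2) \<ge> 0" by simp
  ultimately show ?thesis by linarith
qed

text \<open>Nonnegativity of the variance; \<open>]0,1[\<close> has measure 1, so no length factor
  appears.\<close>

lemma lebI_square_integral:
  assumes "bddm v" shows "(LINT y|lebI. v y)\<^sup>2 \<le> (LINT y|lebI. (v y)\<^sup>2)"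
proof -
  define \<mu> where "\<mu> = (LINT y|lebI. v y)"
  have int: "integrable lebI v" "integrable lebI (\<lambda>y. (v y)\<^sup>2)" "integrable lebI (\<lambda>y. c)" for c :: real
    using bddm_integrable[OF assms] bddm_integrable[OF bddm_mult[OF assms assms]]
      bddm_integrable[OF bddm_const] by (auto simp: power2_eq_square)
  have "0 \<le> (LINT y|lebI. (v y - \<mu>)\<^sup>2)" by simp
  also have "\<dots> = (LINT y|lebI. (v y)\<^sup>2 - (2 * \<mu>) * v y + \<mu>\<^sup>2)"
    by (simp add: power2_diff algebra_simps)
  also have "\<dots> = (LINT y|lebI. (v y)\<^sup>2) - 2 * \<mu> * \<mu> + \<mu>\<^sup>2"
    using int by (simp add: \<mu>_def[symmetric] measure_restrict_space)
  finally show ?thesis by (simp add: \<mu>_def[symmetric] power2_eq_square)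
qed

lemma square_integrable_imp_integrable:
  fixes \<rho> :: "real \<Rightarrow> real"
  assumes "\<rho> \<in> borel_measurable lebI" "integrable lebI (\<lambda>y. (\<rho> y)\<^sup>2)"
  shows "integrable lebI \<rho>"
proof (rule Bochner_Integration.integrable_bound)
  show "integrable lebI (\<lambda>y. 1 + (\<rho> y)\<^sup>2)"
    using assms bddm_integrable[OF bddm_const] by simp
  have "\<bar>x\<bar> \<le> 1 + x\<^sup>2" for x :: real
    using zero_le_power2[of "\<bar>x\<bar> - 1"] by (simp add: power2_diff)
  then show "AE y in lebI. norm (\<rho> y) \<le> norm (1 + (\<rho> y)\<^sup>2)" by simp
qed (use assms in auto)

lemma square_integrable_mult_bddm:
  fixes \<rho> :: "real \<Rightarrow> real"
  assumes "\<rho> \<in> borel_measurable lebI" "integrable lebI (\<lambda>y. (\<rho> y)\<^sup>2)" "bddm w"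
  shows "integrable lebI (\<lambda>y. \<rho> y * w y)"
proof -
  obtain C where C: "\<forall>y\<in>{0<..<1}. \<bar>w y\<bar> \<le> C" using assms(3) unfolding bddm_def by blast
  show ?thesis
  proof (rule Bochner_Integration.integrable_bound)
    show "integrable lebI (\<lambda>y. \<rho> y * C)"
      using square_integrable_imp_integrable[OF assms(1,2)] by simp
    have "norm (\<rho> y * w y) \<le> norm (\<rho> y * C)" if "y \<in> {0<..<1}" for y
      using C that unfolding norm_mult by (intro mult_left_mono) force+
    then show "AE y in lebI. norm (\<rho> y * w y) \<le> norm (\<rho> y * C)"
      by (intro AE_I2) simp
  qed (use assms in \<open>auto simp: bddm_def\<close>)
qed

section \<open>The finite element space\<close>

locale fe_mesh =
  fixes \<T> :: "real set set" and h :: real and k :: nat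
  assumes mesh: "mesh \<T> h"
begin

abbreviation "S \<equiv> S_hk \<T> k"

text \<open>Described through interiors of cells because \<open>mesh\<close> leaves open which of
  two neighbouring cells owns their common end point.\<close>

definition nodes :: "real set" where "nodes = {0<..<1} - (\<Union>K\<in>\<T>. interior K)"

lemma finite_mesh: "finite \<T>" and Union_mesh: "\<Union>\<T> = {0<..<1}"
  and mesh_cell: "K \<in> \<T> \<Longrightarrow> is_interval K" "K \<in> \<T> \<Longrightarrow> interior K \<noteq> {}"
  using mesh unfolding mesh_def partition_on_def by auto

text \<open>An interval exceeds its interior by at most its two end points, and every node lies in
  one of the finitely many cells.\<close>

lemma finite_nodes: "finite nodes"
proof -
  have "finite (K - interior K)" if "K \<in> \<T>" for K
  proof -
    from is_real_interval[OF mesh_cell(1)[OF that]] obtain a b where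
      "K = {} \<or> K = UNIV \<or> K = {..<b} \<or> K = {..b} \<or> K = {a<..} \<or> K = {a..} \<or>
       K = {a<..<b} \<or> K = {a<..b} \<or> K = {a..<b} \<or> K = {a..b}" by blast
    moreover have "{a<..b} - {a<..<b} \<subseteq> {b}" "{a..<b} - {a<..<b} \<subseteq> {a}" "{a..b} - {a<..<b} \<subseteq> {a,b}"
      "{..b} - {..<b} \<subseteq> {b}" "{a..} - {a<..} \<subseteq> {a}" by auto
    ultimately show ?thesis
      by (auto simp: interior_open intro: finite_subset[of _ "{a,b}"])
  qed
  then have "finite (\<Union>K\<in>\<T>. K - interior K)" using finite_mesh by blast
  moreover have "nodes \<subseteq> (\<Union>K\<in>\<T>. K - interior K)"
    using Union_mesh by (auto simp: nodes_def)
  ultimately show ?thesis by (rule rev_finite_subset)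
qed

lemma notin_nodes:
  assumes "y \<in> {0<..<1} - nodes" obtains K where "K \<in> \<T>" "y \<in> interior K"
  using assms unfolding nodes_def by blast

lemma mesh_subset: "K \<in> \<T> \<Longrightarrow> K \<subseteq> {0<..<1}"
  using Union_mesh by blast

lemma S_continuous: "v \<in> S \<Longrightarrow> continuous_on {0..1} v"
  unfolding S_hk_def by auto

lemma S_poly:
  assumes "v \<in> S" "K \<in> \<T>"
  obtains p :: "real poly" where "degree p \<le> k" "\<And>y. y \<in> K \<Longrightarrow> v y = poly p y"
  using assms unfolding S_hk_def by blast

lemma S_boundary: "v \<in> S \<Longrightarrow> v 0 = 0 \<and> v 1 = 0"
  unfolding S_hk_def by auto

lemma lin_closed_S: "lin_closed S"
  unfolding lin_closed_def
proof (intro conjI ballI allI)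
  have "\<exists>p::real poly. degree p \<le> k \<and> (\<forall>y\<in>K. 0 = poly p y)" for K :: "real set"
    by (rule exI[of _ 0]) simp
  then show "(\<lambda>x. 0) \<in> S" by (simp add: S_hk_def)
  fix u v c d assume u: "u \<in> S" and v: "v \<in> S"
  have "\<exists>p::real poly. degree p \<le> k \<and> (\<forall>y\<in>K. c * u y + d * v y = poly p y)" if K: "K \<in> \<T>" for K
  proof -
    obtain p :: "real poly" where p: "degree p \<le> k" "\<And>y. y \<in> K \<Longrightarrow> u y = poly p y"
      using S_poly[OF u K] by blast
    obtain q :: "real poly" where q: "degree q \<le> k" "\<And>y. y \<in> K \<Longrightarrow> v y = poly q y"
      using S_poly[OF v K] by blast
    have "degree (smult c p + smult d q) \<le> k"
      using p(1) q(1) degree_smult_le[of c p] degree_smult_le[of d q] by (intro degree_add_le) linarith+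
    then show ?thesis
      by (intro exI[of _ "smult c p + smult d q"]) (simp add: p(2) q(2))
  qed
  moreover have "continuous_on {0..1} (\<lambda>x. c * u x + d * v x)"
    by (intro continuous_intros S_continuous[OF u] S_continuous[OF v])
  ultimately show "(\<lambda>x. c * u x + d * v x) \<in> S"
    using S_boundary[OF u] S_boundary[OF v] unfolding S_hk_def by simp
qed

text \<open>Near an interior point of a cell, \<open>v\<close> coincides with a polynomial, so its
  derivative is the formal one.\<close>

lemma S_cell_deriv:
  assumes "v \<in> S" "K \<in> \<T>"
  obtains p :: "real poly" where
    "\<And>y. y \<in> interior K \<Longrightarrow> (v has_real_derivative poly p y) (at y)"
    "\<And>y. y \<in> interior K \<Longrightarrow> deriv v y = poly p y"
proof -
  obtain q :: "real poly" where q: "\<And>y. y \<in> K \<Longrightarrow> v y = poly q y"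
    using S_poly[OF assms] by blast
  have "(v has_real_derivative poly (pderiv q) y) (at y)" if y: "y \<in> interior K" for y
  proof (rule has_field_derivative_transform_within_open[OF poly_DERIV open_interior y])
    show "poly q x = v x" if "x \<in> interior K" for x
      using q that interior_subset[of K] by auto
  qed
  then show thesis
    using that[of "pderiv q"] DERIV_imp_deriv by blast
qed

lemma S_has_derivative:
  assumes "v \<in> S" "y \<in> {0<..<1} - nodes"
  shows "(v has_real_derivative deriv v y) (at y)" and "isCont (deriv v) y"
proof -
  obtain K where K: "K \<in> \<T>" "y \<in> interior K" using notin_nodes[OF assms(2)] .
  obtain p where p: "\<And>y. y \<in> interior K \<Longrightarrow> (v has_real_derivative poly p y) (at y)"
    "\<And>y. y \<in> interior K \<Longrightarrow> deriv v y = poly p y"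
    using S_cell_deriv[OF assms(1) K(1)] by blast
  show "(v has_real_derivative deriv v y) (at y)" using p K by simp
  have "continuous_on (interior K) (deriv v)"
    using p(2) by (subst continuous_on_cong[OF refl, of _ _ "poly p"]) (auto intro!: continuous_intros)
  then show "isCont (deriv v) y"
    using K by (simp add: continuous_on_eq_continuous_at)
qed

lemma S_bddm: "v \<in> S \<Longrightarrow> bddm v"
  by (rule bddm_continuous[OF S_continuous])

text \<open>Off the finitely many nodes the derivative is continuous, which gives measurability. It
  is bounded because it is polynomial inside each of finitely many cells and takes finitely many
  values at the nodes.\<close>

lemma S_deriv_bddm: assumes "v \<in> S" shows "bddm (deriv v)"
proof -
  \<comment> \<open>Elements of \<open>S\<close> are unconstrained outside \<open>[0,1]\<close>;
    cutting off there gives a function on the whole line that is continuous off a finite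
    set.\<close>
  define F where "F y = (if y \<in> {0<..<1} then deriv v y else 0)" for y
  let ?N = "nodes \<union> {0,1}"
  have "isCont F y" if "y \<notin> ?N" for y
  proof (cases "y \<in> {0<..<1}")
    case True
    then have "isCont (deriv v) y" using S_has_derivative(2)[OF assms, of y] that by auto
    moreover have "\<forall>\<^sub>F x in nhds y. F x = deriv v x"
      using True by (auto simp: eventually_nhds F_def intro!: exI[of _ "{0<..<1}"])
    ultimately show ?thesis by (simp add: isCont_cong)
  next
    case False
    with that have "y \<in> - {0..1}" by auto
    then have "\<forall>\<^sub>F x in nhds y. F x = 0"
      by (auto simp: eventually_nhds F_def intro!: exI[of _ "- {0..1}"])
    then show ?thesis using isCont_cong[of F "\<lambda>x. 0" y] by simp
  qed
  then have "continuous_on (- ?N) F"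
    by (intro continuous_at_imp_continuous_on) auto
  then have "F \<in> borel_measurable borel"
    by (rule borel_measurable_continuous_countable_exceptions[rotated])
      (auto simp: finite_nodes countable_finite)
  then have "F \<in> borel_measurable lebI"
    by (intro measurable_restrict_space1 measurable_completion) simp
  then have "deriv v \<in> borel_measurable lebI"
    by (rule measurable_cong[THEN iffD1, rotated]) (simp add: F_def)
  moreover have "bounded (deriv v ` {0<..<1})"
  proof (rule bounded_subset)
    have "bounded (deriv v ` interior K)" if K: "K \<in> \<T>" for K
    proof -
      obtain p where p: "\<And>y. y \<in> interior K \<Longrightarrow> deriv v y = poly p y"
        using S_cell_deriv[OF assms K] by metis
      have "compact (poly p ` {0..1})"
        by (intro compact_continuous_image continuous_intros compact_Icc)
      moreover have "deriv v ` interior K \<subseteq> poly p ` {0..1}"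
        using p mesh_subset[OF K] interior_subset[of K] by force
      ultimately show ?thesis using compact_imp_bounded bounded_subset by blast
    qed
    then show "bounded ((\<Union>K\<in>\<T>. deriv v ` interior K) \<union> deriv v ` nodes)"
      using finite_mesh finite_nodes by (auto intro: finite_imp_bounded)
    show "deriv v ` {0<..<1} \<subseteq> (\<Union>K\<in>\<T>. deriv v ` interior K) \<union> deriv v ` nodes"
      unfolding nodes_def by blast
  qed
  ultimately show ?thesis unfolding bddm_def bounded_iff by auto
qed

text \<open>A polynomial of degree at most \<open>k\<close> with \<open>k + 1\<close> zeros is zero,
  and each cell, having nonempty interior, contains that many points. This supplies the point set
  for \<open>positive_form_solvable\<close>.\<close>

lemma S_determined:
  "\<exists>P. finite P \<and> P \<subseteq> {0<..<1} \<and> (\<forall>v\<in>S. (\<forall>p\<in>P. v p = 0) \<longrightarrow> (\<forall>y\<in>{0<..<1}. v y = 0))"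
proof -
  have "\<exists>Q. finite Q \<and> card Q = Suc k \<and> Q \<subseteq> K" if K: "K \<in> \<T>" for K
  proof -
    have "infinite K"
      using mesh_cell(2)[OF K] finite_subset[OF interior_subset] open_interior finite_imp_not_open by blast
    then show ?thesis using infinite_arbitrarily_large by blast
  qed
  then obtain Q where Q: "\<And>K. K \<in> \<T> \<Longrightarrow> finite (Q K) \<and> card (Q K) = Suc k \<and> Q K \<subseteq> K"
    by metis
  have zero: "v y = 0" if v: "v \<in> S" "\<forall>p\<in>(\<Union>K\<in>\<T>. Q K). v p = 0" and y: "y \<in> {0<..<1}" for v y
  proof -
    obtain K where K: "K \<in> \<T>" "y \<in> K" using y Union_mesh by blast
    obtain q :: "real poly" where q: "degree q \<le> k" "\<And>y. y \<in> K \<Longrightarrow> v y = poly q y"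
      using S_poly[OF v(1) K(1)] by blast
    have "q = 0"
    proof (rule ccontr)
      assume "q \<noteq> 0"
      have "Q K \<subseteq> {x. poly q x = 0}" using Q[OF K(1)] q v(2) K(1) by (metis (mono_tags, lifting) UN_I mem_Collect_eq subset_iff)
      then have "card (Q K) \<le> card {x. poly q x = 0}"
        using poly_roots_finite[OF \<open>q \<noteq> 0\<close>] by (rule card_mono[rotated])
      with card_poly_roots_bound[OF \<open>q \<noteq> 0\<close>] Q[OF K(1)] q(1) show False by simp
    qed
    with q K show "v y = 0" by simp
  qed
  show ?thesis
    by (rule exI[of _ "\<Union>K\<in>\<T>. Q K"]) (use Q finite_mesh mesh_subset zero in \<open>blast\<close>)
qed

text \<open>Only almost everywhere: at a node \<open>deriv\<close> may be an arbitrary value that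
  does not respect sums.\<close>

lemma S_deriv_lin:
  assumes "u \<in> S" "v \<in> S"
  shows "AE y in lebI. deriv (\<lambda>x. c * u x + d * v x) y = c * deriv u y + d * deriv v y"
proof (rule AE_lebI_finite[OF finite_nodes])
  fix y assume y: "y \<in> {0<..<1} - nodes"
  show "deriv (\<lambda>x. c * u x + d * v x) y = c * deriv u y + d * deriv v y"
    by (rule DERIV_imp_deriv)
      (auto intro!: derivative_eq_intros S_has_derivative(1)[OF assms(1) y] S_has_derivative(1)[OF assms(2) y])
qed

lemma lin_on_integral:
  assumes "\<And>u. u \<in> S \<Longrightarrow> integrable lebI (\<lambda>y. u y * g y)"
  shows "lin_on S (\<lambda>u. LINT y|lebI. u y * g y)"
  using assms by (auto simp: lin_on_def distrib_right mult.assoc)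

lemma lin_on_integral_deriv:
  assumes "bddm g"
  shows "lin_on S (\<lambda>u. LINT y|lebI. deriv u y * g y)"
  unfolding lin_on_def
proof (intro ballI allI)
  fix u v c d assume u: "u \<in> S" and v: "v \<in> S"
  have int: "integrable lebI (\<lambda>y. deriv w y * g y)" if "w \<in> S" for w
    by (intro bddm_integrable bddm_mult assms S_deriv_bddm that)
  have w: "(\<lambda>x. c * u x + d * v x) \<in> S" by (rule lin_closedD[OF lin_closed_S u v])
  have "(LINT y|lebI. deriv (\<lambda>x. c * u x + d * v x) y * g y)
      = (LINT y|lebI. c * (deriv u y * g y) + d * (deriv v y * g y))"
  proof (rule integral_cong_AE)
    show "AE y in lebI. deriv (\<lambda>x. c * u x + d * v x) y * g y
        = c * (deriv u y * g y) + d * (deriv v y * g y)"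
      using S_deriv_lin[OF u v, of c d] by eventually_elim (simp add: algebra_simps)
  qed (use int[OF w] int[OF u] int[OF v] in auto)
  also have "\<dots> = c * (LINT y|lebI. deriv u y * g y) + d * (LINT y|lebI. deriv v y * g y)"
    using int[OF u] int[OF v] by simp
  finally show "(LINT y|lebI. deriv (\<lambda>x. c * u x + d * v x) y * g y)
    = c * (LINT y|lebI. deriv u y * g y) + d * (LINT y|lebI. deriv v y * g y)" .
qed

text \<open>Integrate the derivative of \<open>(r + s * y) / 2 * (v y)^2\<close>, whose values at 0
  and 1 vanish.\<close>

lemma S_integration_by_parts:
  assumes "v \<in> S"
  shows "(LINT y|lebI. (r + s * y) * deriv v y * v y) = - (s / 2) * (LINT y|lebI. (v y)\<^sup>2)"
proof -
  define H where "H y = (r + s * y) / 2 * (v y)\<^sup>2" for y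
  define H' where "H' y = (r + s * y) * deriv v y * v y + s / 2 * (v y)\<^sup>2" for y
  have v2: "bddm (\<lambda>y. (v y)\<^sup>2)"
    using bddm_mult[OF S_bddm[OF assms] S_bddm[OF assms]] by (simp add: power2_eq_square)
  have lin: "bddm (\<lambda>y. r + s * y)" by (intro bddm_continuous continuous_intros)
  have int1: "integrable lebI (\<lambda>y. (r + s * y) * deriv v y * v y)"
    by (intro bddm_integrable bddm_mult lin S_deriv_bddm S_bddm assms)
  have "(H' has_integral (H 1 - H 0)) {0..1}"
  \<comment> \<open>Finitely many exceptional points are allowed because the primitive is continuous
    on \<open>[0,1]\<close>; here continuity of \<open>v\<close> across the nodes enters.\<close>
  proof (rule fundamental_theorem_of_calculus_interior_strong[OF finite_nodes])
    fix y assume "y \<in> {0<..<1} - nodes"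
    from S_has_derivative(1)[OF assms this]
    show "(H has_vector_derivative H' y) (at y)"
      unfolding has_real_derivative_iff_has_vector_derivative[symmetric] H_def H'_def
      by (auto intro!: derivative_eq_intros simp: field_simps power2_eq_square)
  qed (auto simp: H_def intro!: continuous_intros S_continuous[OF assms])
  moreover have "H 1 = 0" "H 0 = 0" using S_boundary[OF assms] by (simp_all add: H_def)
  ultimately have "integral {0<..<1} H' = 0"
    by (simp add: has_integral_Icc_iff_Ioo integral_unique)
  moreover have "(LINT y|lebI. H' y) = integral {0<..<1} H'"
    by (rule lebesgue_integral_eq_integral)
      (use int1 bddm_integrable[OF v2] in \<open>auto simp: H'_def\<close>)
  moreover have "(LINT y|lebI. H' y)
      = (LINT y|lebI. (r + s * y) * deriv v y * v y) + s / 2 * (LINT y|lebI. (v y)\<^sup>2)"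
    unfolding H'_def using int1 bddm_integrable[OF v2] by simp
  ultimately show ?thesis by simp
qed

end

section \<open>The linear problem with frozen diffusion coefficient\<close>

text \<open>The problem for one midpoint component \<open>X\<close>: \<open>\<kappa>\<close> will be
  \<open>2 / \<delta>\<close>, \<open>r + s * y\<close> the coefficient \<open>b1\<close> at the
  midpoint in time, and \<open>\<rho>\<close> the source plus \<open>\<kappa>\<close> times the old
  value. The diffusion coefficient \<open>c\<close> is not fixed, since solutions for different
  \<open>c\<close> get compared.\<close>

locale frozen_problem = fe_mesh +
  fixes \<kappa> r s :: real and \<rho> :: "real \<Rightarrow> real"
  assumes \<kappa>: "\<kappa> > 0" and s: "s \<ge> 0"
    and \<rho>_meas: "\<rho> \<in> borel_measurable lebI" and \<rho>_sq: "integrable lebI (\<lambda>y. (\<rho> y)\<^sup>2)"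
begin

definition form :: "real \<Rightarrow> (real \<Rightarrow> real) \<Rightarrow> (real \<Rightarrow> real) \<Rightarrow> real" where
  "form c u w = \<kappa> * (LINT y|lebI. u y * w y) + c * (LINT y|lebI. deriv u y * deriv w y)
     - (LINT y|lebI. (r + s * y) * deriv u y * w y)"

definition load :: "(real \<Rightarrow> real) \<Rightarrow> real" where
  "load w = (LINT y|lebI. \<rho> y * w y)"

lemma form_bilin: "bilin_on S (form c)"
  unfolding bilin_on_def
proof (intro ballI conjI)
  fix w assume w: "w \<in> S"
  have lin: "bddm (\<lambda>y. r + s * y)" by (intro bddm_continuous continuous_intros)
  have comb: "lin_on S (\<lambda>u. \<kappa> * l1 u + c * l2 u - l3 u)"
    if "lin_on S l1" "lin_on S l2" "lin_on S l3" for l1 l2 l3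
    using that by (auto simp: lin_on_def algebra_simps)
  have val: "lin_on S (\<lambda>u. LINT y|lebI. u y * g y)" if "bddm g" for g
    by (intro lin_on_integral bddm_integrable bddm_mult S_bddm that)
  have "lin_on S (\<lambda>u. LINT y|lebI. deriv u y * ((r + s * y) * w y))"
    by (intro lin_on_integral_deriv bddm_mult lin S_bddm w)
  then show "lin_on S (\<lambda>u. form c u w)"
    unfolding form_def
    by (intro comb val lin_on_integral_deriv S_bddm S_deriv_bddm w) (simp add: ac_simps)
  have "lin_on S (\<lambda>u. LINT y|lebI. u y * w y)" by (intro val S_bddm w)
  moreover have "lin_on S (\<lambda>u. LINT y|lebI. deriv u y * deriv w y)"
    by (intro lin_on_integral_deriv S_deriv_bddm w)
  moreover have "lin_on S (\<lambda>u. LINT y|lebI. u y * ((r + s * y) * deriv w y))"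
    by (intro val bddm_mult lin S_deriv_bddm w)
  ultimately show "lin_on S (form c w)"
    unfolding form_def by (intro comb) (simp_all add: ac_simps)
qed

lemma load_lin: "lin_on S load"
proof -
  have "lin_on S (\<lambda>w. LINT y|lebI. w y * \<rho> y)"
    by (rule lin_on_integral, subst mult.commute)
      (rule square_integrable_mult_bddm[OF \<rho>_meas \<rho>_sq S_bddm])
  moreover have "load = (\<lambda>w. LINT y|lebI. w y * \<rho> y)"
    unfolding load_def by (simp add: mult.commute fun_eq_iff)
  ultimately show ?thesis by simp
qed

text \<open>On the diagonal the convection term contributes \<open>s / 2\<close> times the squared
  norm, which is dropped as \<open>s\<close> is nonnegative. Hence coercivity for every positive
  \<open>\<kappa>\<close>.\<close>

lemma form_diag:
  assumes "v \<in> S"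
  shows "form c v v \<ge> \<kappa> * (LINT y|lebI. (v y)\<^sup>2) + c * (LINT y|lebI. (deriv v y)\<^sup>2)"
proof -
  have "form c v v = \<kappa> * (LINT y|lebI. (v y)\<^sup>2) + c * (LINT y|lebI. (deriv v y)\<^sup>2)
      + s / 2 * (LINT y|lebI. (v y)\<^sup>2)"
    unfolding form_def S_integration_by_parts[OF assms] by (simp add: power2_eq_square)
  moreover have "s / 2 * (LINT y|lebI. (v y)\<^sup>2) \<ge> 0" using s by simp
  ultimately show ?thesis by linarith
qed

lemma form_solvable:
  assumes "c > 0" shows "\<exists>u\<in>S. \<forall>w\<in>S. form c u w = load w"
proof -
  obtain P where P: "finite P" "P \<subseteq> {0<..<1}"
      "\<And>v y. v \<in> S \<Longrightarrow> \<forall>p\<in>P. v p = 0 \<Longrightarrow> y \<in> {0<..<1} \<Longrightarrow> v y = 0"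
    using S_determined by metis
  show ?thesis
  proof (rule positive_form_solvable[OF P(1) lin_closed_S form_bilin load_lin])
    fix v assume v: "v \<in> S" "\<exists>p\<in>P. v p \<noteq> 0"
    then obtain p where "p \<in> {0<..<1}" "v p \<noteq> 0" using P(2) by blast
    then have "\<kappa> * (LINT y|lebI. (v y)\<^sup>2) > 0"
      using lebI_integral_pos[OF S_continuous[OF v(1)]] \<kappa> by simp
    moreover have "c * (LINT y|lebI. (deriv v y)\<^sup>2) \<ge> 0" using assms by simp
    ultimately show "form c v v > 0" using form_diag[OF v(1), of c] by linarith
  next
    fix v assume v: "v \<in> S" "\<forall>p\<in>P. v p = 0"
    have "load v = (LINT y|lebI. 0)"
      unfolding load_def by (rule Bochner_Integration.integral_cong) (auto simp: P(3)[OF v])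
    then show "load v = 0" by simp
    fix w assume "w \<in> S"
    \<comment> \<open>\<open>v\<close> vanishes on the whole open interval, so its derivative is
      zero even at the nodes.\<close>
    have d0: "deriv v y = 0" if y: "y \<in> {0<..<1}" for y
      by (rule DERIV_imp_deriv, rule has_field_derivative_transform_within_open[OF DERIV_const _ y])
        (auto simp: P(3)[OF v])
    have "(LINT y|lebI. w y * v y) = (LINT y|lebI. 0)"
      "(LINT y|lebI. deriv w y * deriv v y) = (LINT y|lebI. 0)"
      "(LINT y|lebI. (r + s * y) * deriv w y * v y) = (LINT y|lebI. 0)"
      by (rule Bochner_Integration.integral_cong; auto simp: P(3)[OF v] d0)+
    then show "form c w v = 0" unfolding form_def by simp
  qed
qed

text \<open>A choice is made because values outside \<open>[0,1]\<close> are free, so that solutions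
  are not unique as functions on the line.\<close>

definition sol :: "real \<Rightarrow> real \<Rightarrow> real" where
  "sol c = (SOME u. u \<in> S \<and> (\<forall>w\<in>S. form c u w = load w))"

lemma sol: assumes "c > 0"
  shows "sol c \<in> S" "w \<in> S \<Longrightarrow> form c (sol c) w = load w"
proof -
  have "\<exists>u. u \<in> S \<and> (\<forall>w\<in>S. form c u w = load w)"
    using form_solvable[OF assms] by blast
  from someI_ex[OF this] show "sol c \<in> S" "w \<in> S \<Longrightarrow> form c (sol c) w = load w"
    by (auto simp: sol_def)
qed

text \<open>Energy estimate: test the equation with its own solution. Diffusion only helps, so the
  bound is uniform in \<open>c\<close>.\<close>

lemma sol_bounded: "\<exists>R. \<forall>c>0. \<bar>LINT y|lebI. sol c y\<bar> \<le> R"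
proof (intro exI allI impI)
  fix c :: real assume c: "c > 0"
  define v where "v = sol c"
  have v: "v \<in> S" unfolding v_def by (rule sol(1)[OF c])
  define Q where "Q = (LINT y|lebI. (\<rho> y)\<^sup>2)"
  define m where "m = (LINT y|lebI. (v y)\<^sup>2)"
  have int: "integrable lebI (\<lambda>y. (v y)\<^sup>2)"
    using bddm_integrable[OF bddm_mult[OF S_bddm[OF v] S_bddm[OF v]]] by (simp add: power2_eq_square)
  \<comment> \<open>Young's inequality, weighted so that half of \<open>\<kappa> * m\<close> is
    absorbed on the left.\<close>
  have young: "\<rho> y * v y \<le> \<kappa> / 2 * (v y)\<^sup>2 + 1 / (2 * \<kappa>) * (\<rho> y)\<^sup>2" for y
  proof -
    have "0 \<le> (\<kappa> * v y - \<rho> y)\<^sup>2 / (2 * \<kappa>)" using \<kappa> by simp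
    also have "\<dots> = \<kappa> / 2 * (v y)\<^sup>2 + 1 / (2 * \<kappa>) * (\<rho> y)\<^sup>2 - \<rho> y * v y"
      using \<kappa> by (simp add: field_simps power2_eq_square)
    finally show ?thesis by simp
  qed
  have "c * (LINT y|lebI. (deriv v y)\<^sup>2) \<ge> 0" using c by simp
  then have "\<kappa> * m \<le> load v"
    using form_diag[OF v, of c] sol(2)[OF c v] unfolding m_def v_def by linarith
  also have "\<dots> \<le> (LINT y|lebI. \<kappa> / 2 * (v y)\<^sup>2 + 1 / (2 * \<kappa>) * (\<rho> y)\<^sup>2)"
    unfolding load_def
    by (rule integral_mono) (use young int \<rho>_sq square_integrable_mult_bddm[OF \<rho>_meas \<rho>_sq S_bddm[OF v]] in auto)
  also have "\<dots> = \<kappa> / 2 * m + 1 / (2 * \<kappa>) * Q"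
    unfolding m_def Q_def using int \<rho>_sq by simp
  finally have "m \<le> Q / \<kappa>\<^sup>2"
    using \<kappa> by (simp add: field_simps power2_eq_square)
  moreover have "(LINT y|lebI. v y)\<^sup>2 \<le> m"
    unfolding m_def by (rule lebI_square_integral[OF S_bddm[OF v]])
  ultimately have "(LINT y|lebI. v y)\<^sup>2 \<le> Q / \<kappa>\<^sup>2" by linarith
  \<comment> \<open>The existential bound is instantiated only here; it involves
    \<open>\<rho>\<close> and \<open>\<kappa>\<close> but not \<open>c\<close>.\<close>
  then show "\<bar>LINT y|lebI. sol c y\<bar> \<le> sqrt ((LINT y|lebI. (\<rho> y)\<^sup>2) / \<kappa>\<^sup>2)"
    unfolding v_def Q_def by (rule real_le_rsqrt[of "\<bar>_\<bar>", unfolded power2_abs])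
qed

text \<open>Test the difference of the two equations with \<open>E\<close>, the difference of the
  solutions. The two forms differ only in the diffusion term, leaving \<open>d - c\<close> times an
  integral of derivatives.\<close>

lemma sol_diff_bound:
  assumes c: "c > 0" and d: "d > 0"
  shows "\<bar>(LINT y|lebI. sol c y) - (LINT y|lebI. sol d y)\<bar>
    \<le> \<bar>d - c\<bar> * sqrt ((LINT y|lebI. (deriv (sol d) y)\<^sup>2) / (4 * c * \<kappa>))"
proof -
  define E where "E = (\<lambda>x. 1 * sol c x + (- 1) * sol d x)"
  define g where "g = deriv (sol d)"
  define e where "e = deriv E"
  note cS = sol(1)[OF c] and dS = sol(1)[OF d]
  have E: "E \<in> S" unfolding E_def by (rule lin_closedD[OF lin_closed_S cS dS])
  have "form c E E = form c (sol c) E - form c (sol d) E"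
    using lin_onD[OF bilin_onD1[OF form_bilin E] cS dS, of c 1 "-1"] by (simp add: E_def)
  also have "\<dots> = form d (sol d) E - form c (sol d) E"
    using sol(2)[OF c E] sol(2)[OF d E] by simp
  also have "\<dots> = (d - c) * (LINT y|lebI. g y * e y)"
    unfolding form_def g_def e_def by (simp add: algebra_simps)
  finally have eq: "form c E E = (LINT y|lebI. (d - c) * (g y * e y))" by simp
  have bg: "bddm g" and be: "bddm e"
    unfolding g_def e_def by (rule S_deriv_bddm[OF dS] S_deriv_bddm[OF E])+
  have int: "integrable lebI (\<lambda>y. (g y)\<^sup>2)" "integrable lebI (\<lambda>y. (e y)\<^sup>2)"
      "integrable lebI (\<lambda>y. g y * e y)"
    using bddm_integrable[OF bddm_mult] bg be by (auto simp: power2_eq_square)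
  \<comment> \<open>The weight makes the term in \<open>e\<close> cancel exactly against the
    diffusion term of \<open>form_diag\<close>.\<close>
  have young: "(d - c) * (g y * e y) \<le> c * (e y)\<^sup>2 + (d - c)\<^sup>2 / (4 * c) * (g y)\<^sup>2" for y
  proof -
    have "0 \<le> (2 * c * e y - (d - c) * g y)\<^sup>2 / (4 * c)" using c by simp
    also have "\<dots> = c * (e y)\<^sup>2 + (d - c)\<^sup>2 / (4 * c) * (g y)\<^sup>2 - (d - c) * (g y * e y)"
      using c by (simp add: field_simps power2_eq_square)
    finally show ?thesis by simp
  qed
  have "\<kappa> * (LINT y|lebI. (E y)\<^sup>2) + c * (LINT y|lebI. (e y)\<^sup>2) \<le> form c E E"
    unfolding e_def by (rule form_diag[OF E])
  also have "\<dots> \<le> (LINT y|lebI. c * (e y)\<^sup>2 + (d - c)\<^sup>2 / (4 * c) * (g y)\<^sup>2)"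
    unfolding eq by (rule integral_mono) (use young int in auto)
  also have "\<dots> = c * (LINT y|lebI. (e y)\<^sup>2) + (d - c)\<^sup>2 / (4 * c) * (LINT y|lebI. (g y)\<^sup>2)"
    using int by simp
  finally have "(LINT y|lebI. (E y)\<^sup>2) \<le> (d - c)\<^sup>2 * ((LINT y|lebI. (g y)\<^sup>2) / (4 * c * \<kappa>))"
    using \<kappa> c by (simp add: field_simps)
  with lebI_square_integral[OF S_bddm[OF E]]
  have "(LINT y|lebI. E y)\<^sup>2 \<le> (d - c)\<^sup>2 * ((LINT y|lebI. (g y)\<^sup>2) / (4 * c * \<kappa>))"
    by linarith
  then have "\<bar>LINT y|lebI. E y\<bar> \<le> \<bar>d - c\<bar> * sqrt ((LINT y|lebI. (g y)\<^sup>2) / (4 * c * \<kappa>))"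
    by (metis real_sqrt_abs real_sqrt_le_mono real_sqrt_mult)
  moreover have "(LINT y|lebI. E y) = (LINT y|lebI. sol c y) - (LINT y|lebI. sol d y)"
    unfolding E_def using bddm_integrable[OF S_bddm[OF cS]] bddm_integrable[OF S_bddm[OF dS]] by simp
  ultimately show ?thesis by (simp add: g_def)
qed

text \<open>For fixed \<open>d\<close> the preceding bound contains only the solution at
  \<open>d\<close>, so it is explicit in \<open>c\<close> and tends to 0.\<close>

lemma sol_continuous:
  "continuous_on {0<..} (\<lambda>c. LINT y|lebI. sol c y)"
proof (intro continuous_at_imp_continuous_on ballI)
  fix d :: real assume d: "d \<in> {0<..}"
  let ?b = "\<lambda>c. \<bar>d - c\<bar> * sqrt ((LINT y|lebI. (deriv (sol d) y)\<^sup>2) / (4 * c * \<kappa>))"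
  have "((\<lambda>c. (LINT y|lebI. sol c y) - (LINT y|lebI. sol d y)) \<longlongrightarrow> 0) (at d)"
  proof (rule Lim_null_comparison)
    have "\<forall>\<^sub>F c in at d. c > 0"
      using d by (intro order_tendstoD(1)[OF tendsto_ident_at]) auto
    then show "\<forall>\<^sub>F c in at d. norm ((LINT y|lebI. sol c y) - (LINT y|lebI. sol d y)) \<le> ?b c"
      by eventually_elim (use d sol_diff_bound in auto)
    have "(?b \<longlongrightarrow> ?b d) (at d)"
      using d \<kappa> by (intro tendsto_intros) auto
    then show "(?b \<longlongrightarrow> 0) (at d)" by simp
  qed
  then show "isCont (\<lambda>c. LINT y|lebI. sol c y) d"
    unfolding isCont_def by (simp add: LIM_zero_iff)
qed

end

section \<open>The nonlinear system as a fixed-point problem\<close>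

theorem theorem11:
  fixes T \<gamma>0 \<gamma>1 \<gamma>'max \<alpha>'max m\<^sub>a M\<^sub>a \<delta> h :: real
    and \<alpha> \<beta> :: "real \<Rightarrow> real"
    and f :: "'e::finite \<Rightarrow> real \<Rightarrow> real \<Rightarrow> real"
    and a :: "'e \<Rightarrow> real ^ 'e \<Rightarrow> real"
    and N k :: nat
    and \<T> :: "real set set"
  assumes "T > 0"
    and "C2_on T \<alpha>" and "C2_on T \<beta>"
    and "L2_on {0<..<T} (deriv_on T \<alpha>)" and "L2_on {0<..<T} (deriv_on T \<beta>)"
    and "mono_on {0..<T} (gam \<alpha> \<beta>)"
    and "\<gamma>0 > 0"
    and "\<And>t. t \<in> {0..T} \<Longrightarrow> \<gamma>0 < gam \<alpha> \<beta> t \<and> gam \<alpha> \<beta> t < \<gamma>1"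
    and "\<And>t. t \<in> {0..T} \<Longrightarrow> \<bar>deriv_on T (gam \<alpha> \<beta>) t\<bar> \<le> \<gamma>'max"
    and "\<And>t. t \<in> {0..T} \<Longrightarrow> \<bar>deriv_on T \<alpha> t\<bar> \<le> \<alpha>'max"
    and "\<And>i. L2_on {(x, t). 0 < t \<and> t < T \<and> \<alpha> t < x \<and> x < \<beta> t} (\<lambda>(x, t). f i x t)"
    and "\<And>i. \<exists>L. L-lipschitz_on UNIV (a i)"
    and "m\<^sub>a > 0"
    and "\<And>i s. m\<^sub>a \<le> a i s \<and> a i s \<le> M\<^sub>a"
    and "\<delta> > 0" and "T = real N * \<delta>"
    and "\<And>i n. n \<in> {1..N} \<Longrightarrow> L2_on {0<..<1} (\<lambda>y. pullback \<alpha> \<beta> (f i) y (time_mid \<delta> n))"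
    and "mesh \<T> h"
    and "k \<ge> 1"
  shows "\<forall>n\<in>{1..N}. \<forall>U. (\<forall>i. U i \<in> S_hk \<T> k) \<longrightarrow>
           (\<exists>V. (\<forall>i. V i \<in> S_hk \<T> k) \<and> crank_nicolson T \<alpha> \<beta> a f \<delta> \<T> k n U V)"
proof (intro ballI allI impI)
  fix n and U :: "'e \<Rightarrow> real \<Rightarrow> real"
  assume n: "n \<in> {1..N}" and U: "\<forall>i. U i \<in> S_hk \<T> k"
  define t where "t = time_mid \<delta> n"
  define \<gamma> where "\<gamma> = gam \<alpha> \<beta> t"
  define r where "r = deriv_on T \<alpha> t / \<gamma>"
  define s where "s = deriv_on T (gam \<alpha> \<beta>) t / \<gamma>"
  define \<kappa> where "\<kappa> = 2 / \<delta>"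
  define g where "g i y = pullback \<alpha> \<beta> (f i) y t" for i y
  \<comment> \<open>As \<open>n\<close> is at least 1, the subtraction \<open>n - 1\<close> is not
    truncated. The midpoint lies strictly inside \<open>]0,T[\<close>, where \<open>deriv_on\<close>
    is the ordinary derivative.\<close>
  have "t = (real n - 1 / 2) * \<delta>"
    using n by (simp add: t_def time_mid_def time_node_def of_nat_diff field_simps)
  moreover have "0 < real n - 1 / 2" "real n - 1 / 2 < real N" using n by auto
  ultimately have t: "t \<in> {0<..<T}"
    using \<open>\<delta> > 0\<close> \<open>T = real N * \<delta>\<close> by simp
  have \<gamma>: "\<gamma> > 0" using assms(7) assms(8)[of t] t by (simp add: \<gamma>_def)
  have \<kappa>: "\<kappa> > 0" using \<open>\<delta> > 0\<close> by (simp add: \<kappa>_def)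
  have "gam \<alpha> \<beta> differentiable_on {0..T}"
    using assms(2,3) unfolding C2_on_def gam_def[abs_def] by (intro derivative_intros) auto
  then have "gam \<alpha> \<beta> differentiable (at t)"
    using t unfolding differentiable_on_def
    by (metis at_within_interior atLeastAtMost_iff greaterThanLessThan_iff interior_atLeastAtMost_real less_imp_le)
  then have "(gam \<alpha> \<beta> has_vector_derivative vector_derivative (gam \<alpha> \<beta>) (at t)) (at t)"
    by (simp add: vector_derivative_works)
  moreover have "vector_derivative (gam \<alpha> \<beta>) (at t) = deriv_on T (gam \<alpha> \<beta>) t"
    using t unfolding deriv_on_def by (subst at_within_interior) auto
  ultimately have "(gam \<alpha> \<beta> has_real_derivative deriv_on T (gam \<alpha> \<beta>) t) (at t)"
    by (simp add: has_real_derivative_iff_has_vector_derivative)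
  \<comment> \<open>Monotonicity of \<open>\<gamma>\<close> enters here; this sign makes the
    convection term harmless for every step size.\<close>
  then have "deriv_on T (gam \<alpha> \<beta>) t \<ge> 0"
    by (rule mono_on_imp_deriv_nonneg[OF assms(6)]) (use t in auto)
  then have s: "s \<ge> 0" using \<gamma> by (simp add: s_def)
  have b1: "b1 T \<alpha> \<beta> y t = r + s * y" for y
    by (simp add: b1_def r_def s_def \<gamma>_def add_divide_distrib)
  have b2: "b2 \<alpha> \<beta> t > 0" using \<gamma> by (simp add: b2_def \<gamma>_def)
  interpret fe_mesh \<T> h k by unfold_locales fact
  have g: "g i \<in> borel_measurable lebI" "integrable lebI (\<lambda>y. (g i y)\<^sup>2)" for i
  proof -
    have "L2_on {0<..<1} (g i)" using assms(17)[OF n] by (simp add: g_def[abs_def] t_def)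
    then show "g i \<in> borel_measurable lebI" "integrable lebI (\<lambda>y. (g i y)\<^sup>2)"
      unfolding L2_on_def set_borel_measurable_def set_integrable_def
      by (auto simp: borel_measurable_restrict_space_iff integrable_restrict_space)
  qed
  have Ub: "bddm (U i)" for i using U by (intro S_bddm) auto
  define \<rho> where "\<rho> i y = g i y + \<kappa> * U i y" for i y
  \<comment> \<open>Only \<open>\<rho>\<close> varies with the component, so \<open>sol\<close> and
    \<open>load\<close> acquire an index while \<open>form\<close> is common to all.\<close>
  interpret frozen_problem \<T> h k \<kappa> r s "\<rho> i" for i
  proof unfold_locales
    show m: "\<rho> i \<in> borel_measurable lebI"
      unfolding \<rho>_def[abs_def] using g(1)[of i] Ub[of i] by (auto simp: bddm_def)
    show "integrable lebI (\<lambda>y. (\<rho> i y)\<^sup>2)"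
    proof (rule Bochner_Integration.integrable_bound)
      show "integrable lebI (\<lambda>y. 2 * (g i y)\<^sup>2 + 2 * \<kappa>\<^sup>2 * (U i y * U i y))"
        using g(2)[of i] bddm_integrable[OF bddm_mult[OF Ub Ub], of i i] by simp
      have "(x + z)\<^sup>2 \<le> 2 * x\<^sup>2 + 2 * z\<^sup>2" for x z :: real
        using zero_le_power2[of "x - z"] by (simp add: power2_eq_square algebra_simps)
      from this[of "g i _" "\<kappa> * U i _"]
      have "(\<rho> i y)\<^sup>2 \<le> 2 * (g i y)\<^sup>2 + 2 * \<kappa>\<^sup>2 * (U i y * U i y)" for y
        by (simp add: \<rho>_def power2_eq_square algebra_simps)
      then show "AE y in lebI. norm ((\<rho> i y)\<^sup>2) \<le> norm (2 * (g i y)\<^sup>2 + 2 * \<kappa>\<^sup>2 * (U i y * U i y))"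
        by (auto intro: order_trans[OF _ abs_ge_self])
    qed (use m in auto)
  qed (fact \<kappa> s)+
  define c where "c i x = a i x * b2 \<alpha> \<beta> t" for i x
  have c: "c i x > 0" for i x
    using b2 assms(13) assms(14)[of i x] by (auto simp: c_def)
  \<comment> \<open>Freeze the nonlocal argument at \<open>x\<close>, solve, and return the nonlocal
    values of the solution.\<close>
  define \<Phi> where "\<Phi> x = (\<chi> i. \<gamma> * (LINT y|lebI. sol i (c i x) y))" for x
  obtain R where R: "\<And>i c. c > 0 \<Longrightarrow> \<bar>LINT y|lebI. sol i c y\<bar> \<le> R i"
    using sol_bounded by metis
  have cont: "continuous_on UNIV \<Phi>"
    unfolding \<Phi>_def
  proof (intro continuous_intros)
    fix i
    have "continuous_on UNIV (a i)"
      using assms(12)[of i] lipschitz_on_continuous_on by blast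
    then have "continuous_on UNIV (c i)"
      unfolding c_def[abs_def] by (intro continuous_intros)
    then show "continuous_on UNIV (\<lambda>x. LINT y|lebI. sol i (c i x) y)"
      by (rule continuous_on_compose2[OF sol_continuous]) (use c in auto)
  qed
  \<comment> \<open>The bounds \<open>R i\<close> hold for every positive coefficient, so
    \<open>\<Phi>\<close> maps the whole space into one ball.\<close>
  define B where "B = (\<Sum>i\<in>UNIV. \<gamma> * R i)"
  have bound: "norm (\<Phi> x) \<le> B" for x
  proof -
    have "norm (\<Phi> x) \<le> (\<Sum>i\<in>UNIV. \<bar>\<Phi> x $ i\<bar>)" by (rule norm_le_l1_cart)
    also have "\<dots> \<le> B"
      unfolding B_def using R[OF c] \<gamma> by (intro sum_mono) (simp add: \<Phi>_def abs_mult)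
    finally show ?thesis .
  qed
  have ne: "cball 0 B \<noteq> ({} :: (real ^ 'e) set)"
    using order_trans[OF norm_ge_zero bound] by simp
  have maps: "\<Phi> \<in> cball 0 B \<rightarrow> cball 0 B"
    using bound by simp
  obtain x where x: "\<Phi> x = x"
    by (rule brouwer[OF compact_cball convex_cball ne continuous_on_subset[OF cont subset_UNIV] maps])
  define X where "X i = sol i (c i x)" for i
  have X: "X i \<in> S_hk \<T> k" for i unfolding X_def by (rule sol(1)[OF c])
  \<comment> \<open>Recovers the new value from the midpoint value \<open>X\<close> and the old
    value \<open>U\<close>.\<close>
  define V where "V i = (\<lambda>y. 2 * X i y + (- 1) * U i y)" for i
  have V: "V i \<in> S_hk \<T> k" for i
    unfolding V_def by (rule lin_closedD[OF lin_closed_S X]) (use U in auto)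
  have mid: "midpt U V = X" by (auto simp: midpt_def V_def fun_eq_iff)
  have x_eq: "(\<chi> j. l_fun (gam \<alpha> \<beta> t) (X j)) = x"
    unfolding l_fun_def set_integral_lebI X_def by (rule x[unfolded \<Phi>_def \<gamma>_def])
  have "(LINT y:{0<..<1}|lebesgue. (V i y - U i y) / \<delta> * W y)
        + a i x * b2 \<alpha> \<beta> t * (LINT y:{0<..<1}|lebesgue. deriv (X i) y * deriv W y)
        - (LINT y:{0<..<1}|lebesgue. b1 T \<alpha> \<beta> y t * deriv (X i) y * W y)
        = (LINT y:{0<..<1}|lebesgue. pullback \<alpha> \<beta> (f i) y t * W y)" if W: "W \<in> S_hk \<T> k" for i W
  proof -
    have int: "integrable lebI (\<lambda>y. X i y * W y)" "integrable lebI (\<lambda>y. U i y * W y)"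
        "integrable lebI (\<lambda>y. g i y * W y)"
      by (intro bddm_integrable bddm_mult S_bddm X W Ub square_integrable_mult_bddm g)+
    \<comment> \<open>The difference quotient is \<open>\<kappa>\<close> times \<open>X - U\<close>;
      its \<open>U\<close> part is what was moved into the load.\<close>
    have "(LINT y|lebI. (V i y - U i y) / \<delta> * W y) = (LINT y|lebI. \<kappa> * (X i y * W y) - \<kappa> * (U i y * W y))"
      using \<open>\<delta> > 0\<close> by (intro Bochner_Integration.integral_cong) (auto simp: V_def \<kappa>_def field_simps)
    also have "\<dots> = \<kappa> * (LINT y|lebI. X i y * W y) - \<kappa> * (LINT y|lebI. U i y * W y)"
      using int by simp
    finally have 1: "(LINT y|lebI. (V i y - U i y) / \<delta> * W y)
      = \<kappa> * (LINT y|lebI. X i y * W y) - \<kappa> * (LINT y|lebI. U i y * W y)" .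
    have "load i W = (LINT y|lebI. g i y * W y + \<kappa> * (U i y * W y))"
      unfolding load_def by (simp add: \<rho>_def algebra_simps)
    also have "\<dots> = (LINT y|lebI. g i y * W y) + \<kappa> * (LINT y|lebI. U i y * W y)"
      using int by simp
    finally have 2: "load i W = (LINT y|lebI. g i y * W y) + \<kappa> * (LINT y|lebI. U i y * W y)" .
    have 3: "form (c i x) (X i) W = load i W" unfolding X_def by (rule sol(2)[OF c W])
    show ?thesis
      using 1 2 3 unfolding set_integral_lebI form_def b1 by (simp add: c_def g_def)
  qed
  then have "crank_nicolson T \<alpha> \<beta> a f \<delta> \<T> k n U V"
    unfolding crank_nicolson_def Let_def t_def[symmetric] mid x_eq by blast
  with V show "\<exists>V. (\<forall>i. V i \<in> S_hk \<T> k) \<and> crank_nicolson T \<alpha> \<beta> a f \<delta> \<T> k n U V" by blast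
qed

end
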